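(* Assume that $(f,f';h)$ satisfies the basic assumptions with parameters $M_f\ge0$ and $M_h\in[0,\infty)$, and put $M=M_f+M_h$. Assume that $S\subset\mathbb{R}^n$ is a compact convex set containing $\operatorname{dom}h$, let $D_S:=\sup\{\|u-u'\|:u,u'\in S\}$, let $C>0$ be a universal constant and let $\bar\varepsilon>0$ be a given tolerance. Consider RPB$(x_0,\lambda,\delta)$ with $x_0\in\operatorname{dom}h$, $\delta=\bar\varepsilon/6$ and prox stepsize $\lambda$ satisfying $$\frac{\bar\varepsilon}{CMM_f}\le\lambda\le\frac{CD_S^2}{\bar\varepsilon},$$ and the associated sequences $\{(\hat z_k,\hat v_k,\hat\varepsilon_k)\}$ and $$\hat\eta_k:=\hat\varepsilon_k+\sup\{\langle\hat v_k,\hat z_k-x\rangle:x\in S\}.$$ Then the overall number of iterations (serious and null) performed by RPB until it finds a $\bar\varepsilon$-solution pair $(\hat z_k,\hat\eta_k)$ is $\mathcal{O}_1(MM_fD_S^2/\bar\varepsilon^2)$.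
   Context: Problem: $\phi^*:=\min\{\phi(x):=f(x)+h(x):x\in\mathbb{R}^n\}$. We say $(f,f';h)$ satisfies the basic assumptions with parameters $(M_f,M_h)$ if: (i) $f,h:\mathbb{R}^n\to(-\infty,+\infty]$ are proper lower semicontinuous convex, $\operatorname{dom}h\subset\operatorname{dom}f$, and $f':\operatorname{dom}h\to\mathbb{R}^n$ satisfies $f'(x)\in\partial f(x)$ for all $x\in\operatorname{dom}h$; (ii) the set $X^*$ of minimizers of $\phi$ is nonempty; (iii) $\|f'(x)\|\le M_f$ for all $x\in\operatorname{dom}h$; (iv) $|h(u)-h(v)|\le M_h\|u-v\|$ for all $u,v\in\operatorname{dom}h$. Here $\|\cdot\|$ is the Euclidean norm. Method RPB$(x_0,\lambda,\delta)$ ($x_0\in\operatorname{dom}h$, $\lambda>0$, $\delta>0$). Set $x_0^c=\tilde x_0=\hat z_0=x_0$, $C_1=\{x_0\}$, $k=1$. For $j=1,2,\dots$: let $f_j(u)=\max\{f(x)+\langle f'(x),u-x\rangle:x\in C_j\}$; let $x_j$ be the unique minimizer and $m_j$ the minimum value over $u\in\mathbb{R}^n$ of $f_j(u)+h(u)+\frac1{2\lambda}\|u-x_{j-1}^c\|^2$; let $\phi_j^\lambda:=\phi+\frac1{2\lambda}\|\cdot-x_{j-1}^c\|^2$; choose $\tilde x_j\in\operatorname{Argmin}\{\phi_j^\lambda(u):u\in\{x_j,\tilde x_{j-1}\}\}$; let $t_j:=\phi_j^\lambda(\tilde x_j)-m_j$. If $t_j\le\delta$ (iteration $j$ is serious):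 choose any finite $C_{j+1}$ with $\{x_j\}\subset C_{j+1}\subset\{x_0,\dots,x_j\}$, set $x_j^c=x_j$, choose $\hat z_k\in\operatorname{Argmin}\{\phi(u):u\in\{\hat z_{k-1},\tilde x_j\}\}$, and increase $k$ by 1. Otherwise (iteration $j$ is null): set $x_j^c=x_{j-1}^c$ and choose any $C_{j+1}$ with $A_j\cup\{x_j\}\subset C_{j+1}\subset C_j\cup\{x_j\}$, where $A_j:=\{x\in C_j:f(x)+\langle f'(x),x_j-x\rangle=f_j(x_j)\}$. The statement holds for all admissible choices. Let $0=j_0<j_1<j_2<\cdots$ be the serious iteration indices ($j=0$ is serious by convention), $z_0=\tilde z_0=x_0$, and for $k\ge1$: $z_k:=x_{j_k}$, $\tilde z_k:=\tilde x_{j_k}$, $\tilde f_k:=f_{j_k}$, $\delta_k:=\phi(\tilde z_k)-(\tilde f_k+h)(z_k)-\frac{1}{2\lambda}\|z_k-z_{k-1}\|^2$, and $$\hat v_k:=\frac{z_0-z_k}{\lambda k},\qquad\hat\varepsilon_k:=\frac1k\sum_{i=1}^k\delta_i+\frac{\|\hat z_k-z_0\|^2-\|\hat z_k-z_k\|^2}{2\lambda k}.$$ A pair $(x,\eta)$ is a $\bar\varepsilon$-solution pair if $0\in\partial_\eta\phi(x)$ (equivalently $\phi(x)-\phi^*\le\eta$) and $\eta\le\bar\varepsilon$. $p=\mathcal{O}_1(q)$ means $p\le\bar c\,(q+1)$ for a constant $\bar c$ (here depending only on $C$). *)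

theory Defs
  imports "HOL-Analysis.Analysis" "HOL-Library.Poly_Mapping"
begin

section \<open>Euclidean spaces of all dimensions inside one type\<close>

text \<open>
  The complexity constant must not depend on the dimension, so the dimension is quantified
  inside the statement. To this end \<open>\<real>\<^sup>n\<close> is realised as the subspace \<open>Rn n\<close> of the type of
  finitely supported real sequences, equipped with the Euclidean inner product
  \<open>\<Sum>i. x\<^sub>i * y\<^sub>i\<close> and the norm and metric topology it induces.
\<close>

instantiation poly_mapping :: (type, real_vector) real_vector
begin

lift_definition scaleR_poly_mapping :: "real \<Rightarrow> ('a \<Rightarrow>\<^sub>0 'b) \<Rightarrow> ('a \<Rightarrow>\<^sub>0 'b)"
  is "\<lambda>c x k. c *\<^sub>R x k"
  by (erule rev_finite_subset) auto

instance
  by standard (transfer; simp add: fun_eq_iff scaleR_add_right scaleR_add_left)+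

end

lemma lookup_scaleR: "Poly_Mapping.lookup (c *\<^sub>R x) k = c *\<^sub>R Poly_Mapping.lookup x k"
  by transfer simp

instantiation poly_mapping :: (type, real_inner) real_inner
begin

definition inner_poly_mapping :: "('a \<Rightarrow>\<^sub>0 'b) \<Rightarrow> ('a \<Rightarrow>\<^sub>0 'b) \<Rightarrow> real"
  where "inner_poly_mapping x y = (\<Sum>k\<in>Poly_Mapping.keys x. inner (Poly_Mapping.lookup x k) (Poly_Mapping.lookup y k))"

definition norm_poly_mapping :: "('a \<Rightarrow>\<^sub>0 'b) \<Rightarrow> real"
  where "norm_poly_mapping x = sqrt (inner x x)"

definition sgn_poly_mapping :: "('a \<Rightarrow>\<^sub>0 'b) \<Rightarrow> ('a \<Rightarrow>\<^sub>0 'b)"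
  where "sgn_poly_mapping x = x /\<^sub>R norm x"

definition dist_poly_mapping :: "('a \<Rightarrow>\<^sub>0 'b) \<Rightarrow> ('a \<Rightarrow>\<^sub>0 'b) \<Rightarrow> real"
  where "dist_poly_mapping x y = norm (x - y)"

definition uniformity_poly_mapping :: "(('a \<Rightarrow>\<^sub>0 'b) \<times> ('a \<Rightarrow>\<^sub>0 'b)) filter"
  where "uniformity_poly_mapping = (INF e\<in>{0 <..}. principal {(x, y). dist x y < e})"

definition open_poly_mapping :: "('a \<Rightarrow>\<^sub>0 'b) set \<Rightarrow> bool"
  where "open_poly_mapping U \<longleftrightarrow>
    (\<forall>x\<in>U. eventually (\<lambda>(x', y). x' = x \<longrightarrow> y \<in> U) uniformity)"

lemma inner_poly_mapping_superset:
  assumes "finite A" "Poly_Mapping.keys x \<subseteq> A"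
  shows "inner x y = (\<Sum>k\<in>A. inner (Poly_Mapping.lookup x k) (Poly_Mapping.lookup y k))"
  unfolding inner_poly_mapping_def
  by (rule sum.mono_neutral_left) (use assms in \<open>auto simp: in_keys_iff\<close>)

instance
proof
  fix x y z :: "'a \<Rightarrow>\<^sub>0 'b" and c :: real
  show "sgn x = x /\<^sub>R norm x" by (fact sgn_poly_mapping_def)
  show "dist x y = norm (x - y)" by (fact dist_poly_mapping_def)
  show "norm x = sqrt (inner x x)" by (fact norm_poly_mapping_def)
  show "(uniformity :: (('a \<Rightarrow>\<^sub>0 'b) \<times> ('a \<Rightarrow>\<^sub>0 'b)) filter)
      = (INF e\<in>{0 <..}. principal {(x, y). dist x y < e})"
    by (fact uniformity_poly_mapping_def)
  fix U :: "('a \<Rightarrow>\<^sub>0 'b) set"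
  show "open U \<longleftrightarrow> (\<forall>x\<in>U. eventually (\<lambda>(x', y). x' = x \<longrightarrow> y \<in> U) uniformity)"
    by (fact open_poly_mapping_def)
next
  fix x y z :: "'a \<Rightarrow>\<^sub>0 'b" and c :: real
  let ?A = "Poly_Mapping.keys x \<union> Poly_Mapping.keys y \<union> Poly_Mapping.keys z"
  have A: "finite ?A" "Poly_Mapping.keys x \<subseteq> ?A" "Poly_Mapping.keys y \<subseteq> ?A" by auto
  note sup = inner_poly_mapping_superset[OF A(1)]
  show "inner x y = inner y x"
    unfolding sup[OF A(2)] sup[OF A(3)] by (simp add: inner_commute)
  have "Poly_Mapping.keys (x + y) \<subseteq> ?A" using keys_add[of x y] by auto
  then show "inner (x + y) z = inner x z + inner y z"
    unfolding sup[OF A(2)] sup[OF A(3)]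
    by (subst sup) (auto simp: lookup_add inner_add_left sum.distrib)
  have "Poly_Mapping.keys (c *\<^sub>R x) \<subseteq> ?A" by (auto simp: in_keys_iff lookup_scaleR)
  then show "inner (c *\<^sub>R x) y = c * inner x y"
    unfolding sup[OF A(2)]
    by (subst sup) (auto simp: lookup_scaleR sum_distrib_left)
  show "0 \<le> inner x x"
    unfolding inner_poly_mapping_def by (simp add: sum_nonneg)
  show "inner x x = 0 \<longleftrightarrow> x = 0"
    unfolding inner_poly_mapping_def
    by (subst sum_nonneg_eq_0_iff) (auto simp: in_keys_iff intro: poly_mapping_eqI)
qed

end

type_synonym rvec = "nat \<Rightarrow>\<^sub>0 real"

definition Rn :: "nat \<Rightarrow> rvec set"
  where "Rn n = {x. Poly_Mapping.keys x \<subseteq> {..<n}}"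


section \<open>Extended-real-valued convex functions on \<open>\<real>\<^sup>n\<close>\<close>

text \<open>
  A function \<open>g : \<real>\<^sup>n \<rightarrow> (-\<infinity>, +\<infinity>]\<close> is a function \<open>rvec \<Rightarrow> ereal\<close> of which only
  the restriction to \<open>Rn n\<close> is relevant.
\<close>

definition edom :: "nat \<Rightarrow> (rvec \<Rightarrow> ereal) \<Rightarrow> rvec set"
  where "edom n g = {x \<in> Rn n. g x < \<infinity>}"

definition proper_fun :: "nat \<Rightarrow> (rvec \<Rightarrow> ereal) \<Rightarrow> bool"
  where "proper_fun n g \<longleftrightarrow> (\<forall>x\<in>Rn n. g x \<noteq> -\<infinity>) \<and> edom n g \<noteq> {}"

definition lsc_fun :: "nat \<Rightarrow> (rvec \<Rightarrow> ereal) \<Rightarrow> bool"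
  where "lsc_fun n g \<longleftrightarrow> (\<forall>x\<in>Rn n. g x \<le> Liminf (at x within Rn n) g)"

definition convex_fun :: "nat \<Rightarrow> (rvec \<Rightarrow> ereal) \<Rightarrow> bool"
  where "convex_fun n g \<longleftrightarrow>
    (\<forall>x\<in>Rn n. \<forall>y\<in>Rn n. \<forall>t\<in>{0..1}.
      g ((1 - t) *\<^sub>R x + t *\<^sub>R y) \<le> ereal (1 - t) * g x + ereal t * g y)"

definition eps_subdiff :: "nat \<Rightarrow> real \<Rightarrow> (rvec \<Rightarrow> ereal) \<Rightarrow> rvec \<Rightarrow> rvec set"
  where "eps_subdiff n \<eta> g x =
    {s \<in> Rn n. \<forall>u\<in>Rn n. g x + ereal (inner s (u - x)) - ereal \<eta> \<le> g u}"

abbreviation subdiff :: "nat \<Rightarrow> (rvec \<Rightarrow> ereal) \<Rightarrow> rvec \<Rightarrow> rvec set"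
  where "subdiff n \<equiv> eps_subdiff n 0"

text \<open>\<open>f'\<close> is a total function here, but only its values on \<open>dom h\<close> are constrained or used.\<close>

definition basic_assumptions ::
    "nat \<Rightarrow> (rvec \<Rightarrow> ereal) \<Rightarrow> (rvec \<Rightarrow> rvec) \<Rightarrow> (rvec \<Rightarrow> ereal) \<Rightarrow> real \<Rightarrow> real \<Rightarrow> bool"
  where "basic_assumptions n f f' h M\<^sub>f M\<^sub>h \<longleftrightarrow>
    proper_fun n f \<and> lsc_fun n f \<and> convex_fun n f \<and>
    proper_fun n h \<and> lsc_fun n h \<and> convex_fun n h \<and>
    edom n h \<subseteq> edom n f \<and>
    (\<forall>x\<in>edom n h. f' x \<in> subdiff n f x) \<and>
    (\<exists>x. is_arg_min (\<lambda>u. f u + h u) (\<lambda>u. u \<in> Rn n) x) \<and>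
    (\<forall>x\<in>edom n h. norm (f' x) \<le> M\<^sub>f) \<and>
    (\<forall>u\<in>edom n h. \<forall>v\<in>edom n h. \<bar>h u - h v\<bar> \<le> ereal (M\<^sub>h * norm (u - v)))"


section \<open>The method RPB\<close>

text \<open>
  The fields hold \<open>x\<^sub>j\<close>, \<open>x\<^sub>j\<^sup>c\<close>, \<open>\<tilde>x\<^sub>j\<close>, \<open>C\<^sub>j\<close> (for \<open>j \<ge> 1\<close>), indexed by iterations,
  and \<open>\<hat>z\<^sub>k\<close>, indexed by cycles.
\<close>

record rpb_run =
  iter :: "nat \<Rightarrow> rvec"
  center :: "nat \<Rightarrow> rvec"
  best :: "nat \<Rightarrow> rvec"
  cuts :: "nat \<Rightarrow> rvec set"
  zhat :: "nat \<Rightarrow> rvec"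

definition linearization ::
    "(rvec \<Rightarrow> ereal) \<Rightarrow> (rvec \<Rightarrow> rvec) \<Rightarrow> rvec \<Rightarrow> rvec \<Rightarrow> ereal"
  where "linearization f f' x u = f x + ereal (inner (f' x) (u - x))"

definition cut_model ::
    "(rvec \<Rightarrow> ereal) \<Rightarrow> (rvec \<Rightarrow> rvec) \<Rightarrow> rpb_run \<Rightarrow> nat \<Rightarrow> rvec \<Rightarrow> ereal"
  where "cut_model f f' r j u = Max ((\<lambda>x. linearization f f' x u) ` cuts r j)"

definition prox_term :: "real \<Rightarrow> rpb_run \<Rightarrow> nat \<Rightarrow> rvec \<Rightarrow> ereal"
  where "prox_term lam r j u = ereal ((norm (u - center r (j - 1)))\<^sup>2 / (2 * lam))"

definition prox_model ::
    "(rvec \<Rightarrow> ereal) \<Rightarrow> (rvec \<Rightarrow> rvec) \<Rightarrow> (rvec \<Rightarrow> ereal) \<Rightarrow> real \<Rightarrow> rpb_run \<Rightarrow> nat \<Rightarrow> rvec \<Rightarrow> ereal"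
  where "prox_model f f' h lam r j u = cut_model f f' r j u + h u + prox_term lam r j u"

definition prox_obj ::
    "(rvec \<Rightarrow> ereal) \<Rightarrow> (rvec \<Rightarrow> ereal) \<Rightarrow> real \<Rightarrow> rpb_run \<Rightarrow> nat \<Rightarrow> rvec \<Rightarrow> ereal"
  where "prox_obj f h lam r j u = f u + h u + prox_term lam r j u"

definition gap ::
    "nat \<Rightarrow> (rvec \<Rightarrow> ereal) \<Rightarrow> (rvec \<Rightarrow> rvec) \<Rightarrow> (rvec \<Rightarrow> ereal) \<Rightarrow> real \<Rightarrow> rpb_run \<Rightarrow> nat \<Rightarrow> ereal"
  where "gap n f f' h lam r j =
    prox_obj f h lam r j (best r j) - (INF u\<in>Rn n. prox_model f f' h lam r j u)"

definition serious ::
    "nat \<Rightarrow> (rvec \<Rightarrow> ereal) \<Rightarrow> (rvec \<Rightarrow> rvec) \<Rightarrow> (rvec \<Rightarrow> ereal) \<Rightarrow> real \<Rightarrow> real \<Rightarrow> rpb_run \<Rightarrow> nat set"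
  where "serious n f f' h lam \<delta> r = {j. j = 0 \<or> gap n f f' h lam r j \<le> ereal \<delta>}"

definition active_set ::
    "(rvec \<Rightarrow> ereal) \<Rightarrow> (rvec \<Rightarrow> rvec) \<Rightarrow> rpb_run \<Rightarrow> nat \<Rightarrow> rvec set"
  where "active_set f f' r j =
    {x \<in> cuts r j. linearization f f' x (iter r j) = cut_model f f' r j (iter r j)}"

text \<open>
  At a serious iteration \<open>j\<close> the value of the counter \<open>k\<close> before it is increased is the number
  of serious iterations in \<open>{1..j}\<close>. The minimizer \<open>x\<^sub>j\<close> is unique because the objective is
  strongly convex.
\<close>

definition is_RPB ::
    "nat \<Rightarrow> (rvec \<Rightarrow> ereal) \<Rightarrow> (rvec \<Rightarrow> rvec) \<Rightarrow> (rvec \<Rightarrow> ereal) \<Rightarrow>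
      rvec \<Rightarrow> real \<Rightarrow> real \<Rightarrow> rpb_run \<Rightarrow> bool"
  where "is_RPB n f f' h x\<^sub>0 lam \<delta> r \<longleftrightarrow>
    iter r 0 = x\<^sub>0 \<and> center r 0 = x\<^sub>0 \<and> best r 0 = x\<^sub>0 \<and> zhat r 0 = x\<^sub>0 \<and> cuts r 1 = {x\<^sub>0} \<and>
    (\<forall>j\<ge>1.
      is_arg_min (prox_model f f' h lam r j) (\<lambda>u. u \<in> Rn n) (iter r j) \<and>
      is_arg_min (prox_obj f h lam r j) (\<lambda>u. u \<in> {iter r j, best r (j - 1)}) (best r j) \<and>
      (if j \<in> serious n f f' h lam \<delta> r then
        {iter r j} \<subseteq> cuts r (j + 1) \<and> cuts r (j + 1) \<subseteq> iter r ` {0..j} \<and>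
        center r j = iter r j \<and>
        (let k = card (serious n f f' h lam \<delta> r \<inter> {1..j}) in
          is_arg_min (\<lambda>u. f u + h u) (\<lambda>u. u \<in> {zhat r (k - 1), best r j}) (zhat r k))
       else
        center r j = center r (j - 1) \<and>
        active_set f f' r j \<union> {iter r j} \<subseteq> cuts r (j + 1) \<and>
        cuts r (j + 1) \<subseteq> cuts r j \<union> {iter r j}))"

text \<open>
  The serious iteration index \<open>j\<^sub>k\<close>; meaningful only if there are more than \<open>k\<close> serious
  indices (counting \<open>j\<^sub>0 = 0\<close>).
\<close>

definition serious_idx ::
    "nat \<Rightarrow> (rvec \<Rightarrow> ereal) \<Rightarrow> (rvec \<Rightarrow> rvec) \<Rightarrow> (rvec \<Rightarrow> ereal) \<Rightarrow> real \<Rightarrow> real \<Rightarrow> rpb_run \<Rightarrow> nat \<Rightarrow> nat"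
  where "serious_idx n f f' h lam \<delta> r k = enumerate (serious n f f' h lam \<delta> r) k"

definition serious_idx_exists ::
    "nat \<Rightarrow> (rvec \<Rightarrow> ereal) \<Rightarrow> (rvec \<Rightarrow> rvec) \<Rightarrow> (rvec \<Rightarrow> ereal) \<Rightarrow> real \<Rightarrow> real \<Rightarrow> rpb_run \<Rightarrow> nat \<Rightarrow> bool"
  where "serious_idx_exists n f f' h lam \<delta> r k \<longleftrightarrow>
    infinite (serious n f f' h lam \<delta> r) \<or> k < card (serious n f f' h lam \<delta> r)"

definition zseq ::
    "nat \<Rightarrow> (rvec \<Rightarrow> ereal) \<Rightarrow> (rvec \<Rightarrow> rvec) \<Rightarrow> (rvec \<Rightarrow> ereal) \<Rightarrow> real \<Rightarrow> real \<Rightarrow> rpb_run \<Rightarrow> nat \<Rightarrow> rvec"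
  where "zseq n f f' h lam \<delta> r k = iter r (serious_idx n f f' h lam \<delta> r k)"

text \<open>
  All terms below are finite along a run of the method, so the conversion to \<open>real\<close> loses
  nothing.
\<close>

definition delta_seq ::
    "nat \<Rightarrow> (rvec \<Rightarrow> ereal) \<Rightarrow> (rvec \<Rightarrow> rvec) \<Rightarrow> (rvec \<Rightarrow> ereal) \<Rightarrow> real \<Rightarrow> real \<Rightarrow> rpb_run \<Rightarrow> nat \<Rightarrow> real"
  where "delta_seq n f f' h lam \<delta> r k =
    (let j = serious_idx n f f' h lam \<delta> r k;
         z = zseq n f f' h lam \<delta> r
     in real_of_ereal
          ((f (best r j) + h (best r j)) - (cut_model f f' r j (z k) + h (z k))
            - ereal ((norm (z k - z (k - 1)))\<^sup>2 / (2 * lam))))"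

definition vhat ::
    "nat \<Rightarrow> (rvec \<Rightarrow> ereal) \<Rightarrow> (rvec \<Rightarrow> rvec) \<Rightarrow> (rvec \<Rightarrow> ereal) \<Rightarrow> real \<Rightarrow> real \<Rightarrow> rpb_run \<Rightarrow> nat \<Rightarrow> rvec"
  where "vhat n f f' h lam \<delta> r k =
    (zseq n f f' h lam \<delta> r 0 - zseq n f f' h lam \<delta> r k) /\<^sub>R (lam * real k)"

definition epshat ::
    "nat \<Rightarrow> (rvec \<Rightarrow> ereal) \<Rightarrow> (rvec \<Rightarrow> rvec) \<Rightarrow> (rvec \<Rightarrow> ereal) \<Rightarrow> real \<Rightarrow> real \<Rightarrow> rpb_run \<Rightarrow> nat \<Rightarrow> real"
  where "epshat n f f' h lam \<delta> r k =
    (let z = zseq n f f' h lam \<delta> r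
     in (\<Sum>i=1..k. delta_seq n f f' h lam \<delta> r i) / real k
        + ((norm (zhat r k - z 0))\<^sup>2 - (norm (zhat r k - z k))\<^sup>2) / (2 * lam * real k))"

definition etahat ::
    "nat \<Rightarrow> (rvec \<Rightarrow> ereal) \<Rightarrow> (rvec \<Rightarrow> rvec) \<Rightarrow> (rvec \<Rightarrow> ereal) \<Rightarrow> real \<Rightarrow> real \<Rightarrow> rpb_run \<Rightarrow>
      rvec set \<Rightarrow> nat \<Rightarrow> real"
  where "etahat n f f' h lam \<delta> r S k =
    epshat n f f' h lam \<delta> r k + (SUP x\<in>S. inner (vhat n f f' h lam \<delta> r k) (zhat r k - x))"

definition solution_pair ::
    "nat \<Rightarrow> (rvec \<Rightarrow> ereal) \<Rightarrow> (rvec \<Rightarrow> ereal) \<Rightarrow> real \<Rightarrow> rvec \<Rightarrow> real \<Rightarrow> bool"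
  where "solution_pair n f h eps x \<eta> \<longleftrightarrow>
    0 \<in> eps_subdiff n \<eta> (\<lambda>u. f u + h u) x \<and> \<eta> \<le> eps"

end

theory Submission
  imports Defs
begin

text \<open>
  The proof bounds two numbers, the length of a cycle (the null iterations between consecutive
  serious ones) and the number of cycles, and multiplies the bounds. Both rest on one fact: a
  function of the form convex plus \<open>\<parallel>\<cdot> - c\<parallel>\<^sup>2 / (2\<lambda>)\<close> grows from its minimizer \<open>x\<close>
  at least like \<open>\<parallel>\<cdot> - x\<parallel>\<^sup>2 / (2\<lambda>)\<close>. Only the cuts that are active at \<open>x\<close> are needed
  for this growth (\<open>prox_growth_of_active_pieces\<close>), which is why a null step may drop the others.

  Within a cycle the prox center is fixed. The growth bound for the model of iteration \<open>j\<close>, taken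
  at \<open>x\<^bsub>j+1\<^esub>\<close>, raises the minimum value of the model by \<open>\<parallel>x\<^bsub>j+1\<^esub> - x\<^sub>j\<parallel>\<^sup>2 / (2\<lambda>)\<close>, so
  the gap \<open>t\<^sub>j\<close> drops by that much. On the other hand the next model contains the cut at
  \<open>x\<^sub>j\<close>, whence \<open>t\<^bsub>j+1\<^esub> \<le> 2 M\<^sub>f \<parallel>x\<^bsub>j+1\<^esub> - x\<^sub>j\<parallel>\<close>. Eliminating the step length gives
  \<open>t\<^bsub>j+1\<^esub> + t\<^bsub>j+1\<^esub>\<^sup>2 / b \<le> t\<^sub>j\<close> with \<open>b = 8 \<lambda> M M\<^sub>f\<close>. The first step of a cycle has length at
  most \<open>\<lambda> M\<close>, so the first gap is at most \<open>b/4\<close>, and then the recursion reaches \<open>\<delta>\<close> after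
  at most \<open>2b/\<delta> + 1\<close> steps (\<open>quadratic_decay_steps\<close>, \<open>next_serious\<close>). Taking \<open>M M\<^sub>f\<close> in \<open>b\<close>,
  where \<open>M\<^sub>f\<^sup>2\<close> would do for the recursion alone, is what makes the first gap comparable
  with \<open>b\<close> and avoids a logarithmic term.

  Across cycles, the growth bound at a serious iterate together with \<open>model + h \<le> \<phi>\<close> is an
  inequality that telescopes. Its average over the first \<open>k\<close> cycles says that \<open>zhat\<^sub>k\<close> is
  \<open>etahat\<^sub>k\<close>-optimal, with \<open>etahat\<^sub>k \<le> \<delta> + D\<^sub>S\<^sup>2 / (2 \<lambda> k)\<close> (\<open>zhat_eps_optimal\<close>,
  \<open>etahat_bounds\<close>). Hence \<open>k \<approx> D\<^sub>S\<^sup>2 / (\<lambda> eps)\<close> cycles suffice. Each cycle has \<open>O(\<lambda> M M\<^sub>f / eps + 1)\<close>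
  iterations; the two bounds on \<open>\<lambda>\<close> ensure that the additive constants coming from
  rounding are dominated, and in the product \<open>\<lambda>\<close> cancels.
\<close>


section \<open>Quadratic growth at a proximal minimizer\<close>

lemma norm_convex_combination_sq:
  fixes x u c :: "'a::real_inner"
  shows "(norm ((1 - t) *\<^sub>R x + t *\<^sub>R u - c))\<^sup>2
    = (1 - t) * (norm (x - c))\<^sup>2 + t * (norm (u - c))\<^sup>2 - t * (1 - t) * (norm (u - x))\<^sup>2"
  unfolding power2_norm_eq_inner by (simp add: inner_commute algebra_simps inner_simps)

lemma norm_sq_diff_shift:
  fixes x a b w :: "'a::real_inner"
  shows "(norm (x - a))\<^sup>2 - (norm (x - b))\<^sup>2
    = (norm (w - a))\<^sup>2 - (norm (w - b))\<^sup>2 + 2 * inner (a - b) (w - x)"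
  unfolding power2_norm_eq_inner by (simp add: inner_diff_left inner_diff_right inner_commute)

text \<open>
  Comparing \<open>x\<close> with points at distance \<open>O(t)\<close> on the segment to \<open>u\<close>, convexity gives the claim
  with an error of order \<open>t\<close>, which vanishes in the limit. Hence minimality is only required near
  \<open>x\<close>, and only along the segment.
\<close>

lemma prox_growth_of_local_min:
  fixes g :: "'a::real_inner \<Rightarrow> real"
  assumes conv: "convex_on D g" and x: "x \<in> D" and u: "u \<in> D" and lam: "lam > 0"
    and loc: "\<forall>\<^sub>F t in at_right 0. g x + (norm (x - c))\<^sup>2 / (2 * lam)
      \<le> g ((1 - t) *\<^sub>R x + t *\<^sub>R u) + (norm ((1 - t) *\<^sub>R x + t *\<^sub>R u - c))\<^sup>2 / (2 * lam)"
  shows "g x + (norm (x - c))\<^sup>2 / (2 * lam) + (norm (u - x))\<^sup>2 / (2 * lam)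
    \<le> g u + (norm (u - c))\<^sup>2 / (2 * lam)"
proof -
  let ?d = "(g u + (norm (u - c))\<^sup>2 / (2 * lam)) - (g x + (norm (x - c))\<^sup>2 / (2 * lam))"
  let ?q = "(norm (u - x))\<^sup>2 / (2 * lam)"
  have small: "\<forall>\<^sub>F t in at_right (0::real). t < 1"
    by (rule order_tendstoD[OF tendsto_ident_at]) simp
  have pos: "\<forall>\<^sub>F t in at_right (0::real). 0 < t"
    by (simp add: eventually_at_right_less)
  have "\<forall>\<^sub>F t in at_right 0. (1 - t) * ?q \<le> ?d"
    using loc small pos
  proof eventually_elim
    case (elim t)
    have "g ((1 - t) *\<^sub>R x + t *\<^sub>R u) \<le> (1 - t) * g x + t * g u"
      using convex_onD[OF conv, of t x u] elim x u by simp
    with elim(1) have "0 \<le> t * (?d - (1 - t) * ?q)"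
      unfolding norm_convex_combination_sq
      by (simp add: algebra_simps add_divide_distrib diff_divide_distrib)
    with elim(3) show ?case by (simp add: zero_le_mult_iff)
  qed
  moreover have "((\<lambda>t. (1 - t) * ?q) \<longlongrightarrow> (1 - 0) * ?q) (at_right 0)"
    by (intro tendsto_intros)
  ultimately have "(1 - 0) * ?q \<le> ?d"
    by (intro tendsto_upperbound) auto
  then show ?thesis by simp
qed

text \<open>
  A minimizer for all the affine pieces \<open>P\<close> is a local minimizer for the pieces that attain the
  maximum there, because the others remain smaller nearby. By convexity this is enough for the
  growth bound of the reduced maximum, hence also for any finite family \<open>Q\<close> that retains those
  pieces. With \<open>Q = P\<close> this is the growth of the original objective; with \<open>Q\<close> the cuts of the
  next iteration it compares two consecutive models.
\<close>

lemma prox_growth_of_active_pieces: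
  fixes lin :: "'i \<Rightarrow> 'a::real_inner \<Rightarrow> real"
  assumes fin: "finite P" and ne: "P \<noteq> {}"
    and affine: "\<And>p t x u. p \<in> P \<Longrightarrow> lin p ((1 - t) *\<^sub>R x + t *\<^sub>R u) = (1 - t) * lin p x + t * lin p u"
    and conv: "convex_on D H" and x: "x \<in> D" and u: "u \<in> D" and lam: "lam > 0"
    and min: "\<And>y. y \<in> D \<Longrightarrow> Max ((\<lambda>p. lin p x) ` P) + H x + (norm (x - c))\<^sup>2 / (2 * lam)
      \<le> Max ((\<lambda>p. lin p y) ` P) + H y + (norm (y - c))\<^sup>2 / (2 * lam)"
    and A: "{p \<in> P. lin p x = Max ((\<lambda>p. lin p x) ` P)} \<subseteq> Q"
    and Q: "finite Q"
  shows "Max ((\<lambda>p. lin p x) ` P) + H x + (norm (x - c))\<^sup>2 / (2 * lam) + (norm (u - x))\<^sup>2 / (2 * lam)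
    \<le> Max ((\<lambda>p. lin p u) ` Q) + H u + (norm (u - c))\<^sup>2 / (2 * lam)"
proof -
  define A' where "A' = {p \<in> P. lin p x = Max ((\<lambda>p. lin p x) ` P)}"
  have finA: "finite A'" and AP: "A' \<subseteq> P" using fin by (auto simp: A'_def)
  have "Max ((\<lambda>p. lin p x) ` P) \<in> (\<lambda>p. lin p x) ` P"
    using fin ne by (intro Max_in) auto
  then obtain a where a: "a \<in> A'" by (auto simp: A'_def)
  then have neA: "A' \<noteq> {}" by auto
  have lina: "lin p x = Max ((\<lambda>p. lin p x) ` P)" if "p \<in> A'" for p
    using that by (simp add: A'_def)
  define G where "G y = Max ((\<lambda>p. lin p y) ` A') + H y" for y
  have D: "convex D" using conv by (rule convex_on_imp_convex)
  have GA: "convex_on D G"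
  proof (rule convex_onI)
    fix t :: real and y w
    assume t: "0 < t" "t < 1" and yw: "y \<in> D" "w \<in> D"
    have "lin p ((1 - t) *\<^sub>R y + t *\<^sub>R w)
        \<le> (1 - t) * Max ((\<lambda>p. lin p y) ` A') + t * Max ((\<lambda>p. lin p w) ` A')" if "p \<in> A'" for p
    proof -
      have "lin p y \<le> Max ((\<lambda>p. lin p y) ` A')" "lin p w \<le> Max ((\<lambda>p. lin p w) ` A')"
        using that finA by auto
      then show ?thesis
        using t that AP by (subst affine) (auto intro!: add_mono mult_left_mono)
    qed
    then have "Max ((\<lambda>p. lin p ((1 - t) *\<^sub>R y + t *\<^sub>R w)) ` A')
        \<le> (1 - t) * Max ((\<lambda>p. lin p y) ` A') + t * Max ((\<lambda>p. lin p w) ` A')"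
      using finA neA by (subst Max_le_iff) auto
    moreover have "H ((1 - t) *\<^sub>R y + t *\<^sub>R w) \<le> (1 - t) * H y + t * H w"
      using convex_onD[OF conv, of t y w] t yw by simp
    ultimately show "G ((1 - t) *\<^sub>R y + t *\<^sub>R w) \<le> (1 - t) * G y + t * G w"
      by (simp add: G_def algebra_simps)
  qed (rule D)
  have Gx: "G x = Max ((\<lambda>p. lin p x) ` P) + H x"
  proof -
    have "(\<lambda>p. lin p x) ` A' = {Max ((\<lambda>p. lin p x) ` P)}"
      using lina a by auto
    then show ?thesis by (simp add: G_def)
  qed
  let ?s = "\<lambda>t. (1 - t) *\<^sub>R x + t *\<^sub>R u"
  \<comment> \<open>Inactive pieces stay strictly below the active piece \<open>a\<close> on a short initial segment.\<close>
  have inactive: "\<forall>\<^sub>F t in at_right 0. lin p (?s t) < lin a (?s t)" if "p \<in> P - A'" for p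
  proof -
    have lt: "lin p x < lin a x"
    proof -
      have "lin p x \<le> Max ((\<lambda>p. lin p x) ` P)" using that fin by auto
      moreover have "lin p x \<noteq> Max ((\<lambda>p. lin p x) ` P)" using that by (auto simp: A'_def)
      ultimately show ?thesis using lina[OF a] by linarith
    qed
    have "((\<lambda>t. lin q (?s t)) \<longlongrightarrow> (1 - 0) * lin q x + 0 * lin q u) (at_right 0)" if "q \<in> P" for q
      unfolding affine[OF that] by (intro tendsto_intros)
    from this[of a] this[of p] have "((\<lambda>t. lin a (?s t) - lin p (?s t)) \<longlongrightarrow> lin a x - lin p x) (at_right 0)"
      using a AP that by (intro tendsto_diff) auto
    from order_tendstoD(1)[OF this, of 0] lt show ?thesis by simp
  qed
  then have "\<forall>\<^sub>F t in at_right 0. \<forall>p\<in>P - A'. lin p (?s t) < lin a (?s t)"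
    using fin by (intro eventually_ball_finite) auto
  moreover have "\<forall>\<^sub>F t in at_right (0::real). t < 1"
    by (rule order_tendstoD[OF tendsto_ident_at]) simp
  moreover have "\<forall>\<^sub>F t in at_right (0::real). 0 < t"
    by (simp add: eventually_at_right_less)
  ultimately have "\<forall>\<^sub>F t in at_right 0. G x + (norm (x - c))\<^sup>2 / (2 * lam)
      \<le> G (?s t) + (norm (?s t - c))\<^sup>2 / (2 * lam)"
  proof eventually_elim
    case (elim t)
    have sD: "?s t \<in> D" using convexD_alt[OF D x u, of t] elim by simp
    have "lin p (?s t) \<le> Max ((\<lambda>p. lin p (?s t)) ` A')" if "p \<in> P" for p
    proof (cases "p \<in> A'")
      case True then show ?thesis using finA by auto
    next
      case False
      then have "lin p (?s t) < lin a (?s t)" using elim(1) that by auto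
      also have "\<dots> \<le> Max ((\<lambda>p. lin p (?s t)) ` A')" using finA a by auto
      finally show ?thesis by simp
    qed
    then have "Max ((\<lambda>p. lin p (?s t)) ` P) \<le> Max ((\<lambda>p. lin p (?s t)) ` A')"
      using fin ne by (subst Max_le_iff) auto
    with min[OF sD] show ?case unfolding Gx by (simp add: G_def)
  qed
  from prox_growth_of_local_min[OF GA x u lam this]
  have "G x + (norm (x - c))\<^sup>2 / (2 * lam) + (norm (u - x))\<^sup>2 / (2 * lam)
    \<le> G u + (norm (u - c))\<^sup>2 / (2 * lam)" .
  moreover have "Max ((\<lambda>p. lin p u) ` A') \<le> Max ((\<lambda>p. lin p u) ` Q)"
    using A neA Q by (intro Max_mono) (auto simp: A'_def)
  ultimately show ?thesis unfolding Gx by (simp add: G_def)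
qed


section \<open>A quadratic decay recursion\<close>

text \<open>
  The reciprocal \<open>b / \<tau> i\<close> increases by at least \<open>1/2\<close> per step: with \<open>y = \<tau> (i + 1)\<close>,
  the recursion gives \<open>b / \<tau> i \<le> b / (y + y\<^sup>2 / b) = b / y - b / (b + y)\<close>, and \<open>y \<le> b\<close>. But it stays
  below \<open>b / \<delta>\<close> while \<open>\<tau>\<close> stays above \<open>\<delta>\<close>.
\<close>

lemma quadratic_decay_steps:
  fixes \<tau> :: "nat \<Rightarrow> real"
  assumes b: "b > 0" and \<delta>: "\<delta> > 0" and init: "\<tau> 0 \<le> b / 4"
    and step: "\<And>i. i < m \<Longrightarrow> \<tau> (Suc i) + (\<tau> (Suc i))\<^sup>2 / b \<le> \<tau> i"
    and above: "\<And>i. i \<le> m \<Longrightarrow> \<delta> < \<tau> i"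
  shows "real m < 2 * b / \<delta>"
proof -
  have "\<tau> i \<le> b / 4 \<and> real i / 2 \<le> b / \<tau> i" if "i \<le> m" for i
    using that
  proof (induction i)
    case 0
    then show ?case using init b \<delta> above[of 0] by simp
  next
    case (Suc i)
    define x y where "x = \<tau> i" and "y = \<tau> (Suc i)"
    have IH: "x \<le> b / 4" "real i / 2 \<le> b / x" using Suc by (auto simp: x_def)
    have xy: "y + y\<^sup>2 / b \<le> x" using step[of i] Suc.prems by (simp add: x_def y_def)
    have y0: "y > 0" using above[of "Suc i"] Suc.prems \<delta> by (simp add: y_def)
    have yx: "y \<le> x" using xy y0 b by (smt (verit) divide_nonneg_pos zero_le_power2)
    have x0: "x > 0" using yx y0 by linarith
    have "b / x \<le> b / (y + y\<^sup>2 / b)"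
      using xy y0 x0 b by (intro divide_left_mono mult_pos_pos add_pos_pos divide_pos_pos) auto
    also have "\<dots> = b / y - b / (b + y)"
    proof -
      have "y + y\<^sup>2 / b = y * (b + y) / b" using b by (simp add: field_simps power2_eq_square)
      then show ?thesis using b y0 by (simp add: divide_simps) (simp add: algebra_simps)
    qed
    finally have "b / x + b / (b + y) \<le> b / y" by simp
    moreover have "1 / 2 \<le> b / (b + y)"
      using yx IH(1) b y0 by (simp add: field_simps)
    ultimately have "real (Suc i) / 2 \<le> b / y"
      using IH(2) unfolding of_nat_Suc add_divide_distrib by linarith
    then show ?case using yx IH(1) by (simp add: y_def)
  qed
  from this[of m] have "real m / 2 \<le> b / \<tau> m" by simp
  also have "\<dots> < b / \<delta>"
    using above[of m] b \<delta> by (intro divide_strict_left_mono mult_pos_pos) auto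
  finally show ?thesis by (simp add: mult.commute)
qed


section \<open>Runs of the method in real-valued form\<close>

lemma Rn_combination:
  assumes "x \<in> Rn n" "u \<in> Rn n"
  shows "a *\<^sub>R x + b *\<^sub>R u \<in> Rn n"
proof -
  have "Poly_Mapping.keys (a *\<^sub>R x + b *\<^sub>R u) \<subseteq> Poly_Mapping.keys x \<union> Poly_Mapping.keys u"
    by (auto simp: in_keys_iff lookup_add lookup_scaleR)
  then show ?thesis using assms by (auto simp: Rn_def)
qed

text \<open>
  All values met along a run are finite, since every iterate lies in \<open>dom h\<close>. The locale
  replaces \<open>f\<close>, \<open>h\<close> and the cutting plane models by real functions on \<open>dom h\<close>, so that the
  analysis takes place in \<open>\<real>\<close>.
\<close>

locale rpb =
  fixes n f f' h M\<^sub>f M\<^sub>h x\<^sub>0 lam \<delta> r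
  assumes basic: "basic_assumptions n f f' h M\<^sub>f M\<^sub>h"
    and run: "is_RPB n f f' h x\<^sub>0 lam \<delta> r"
    and x0: "x\<^sub>0 \<in> edom n h"
    and lam: "0 < lam" and delta: "0 < \<delta>" and Mf: "0 < M\<^sub>f" and Mh: "0 \<le> M\<^sub>h"
begin

abbreviation D where "D \<equiv> edom n h"
abbreviation Serious where "Serious \<equiv> serious n f f' h lam \<delta> r"

definition F where "F u = real_of_ereal (f u)"
definition H where "H u = real_of_ereal (h u)"
definition lin where "lin p u = F p + inner (f' p) (u - p)"
definition model where "model j u = Max ((\<lambda>p. lin p u) ` cuts r j)"
definition prox where "prox j u = (norm (u - center r (j - 1)))\<^sup>2 / (2 * lam)"

text \<open>
  The gap of iteration \<open>j\<close>, with the minimum of the model written as its value at \<open>x\<^sub>j\<close>.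
\<close>

definition t where
  "t j = (F (best r j) + H (best r j) + prox j (best r j))
    - (model j (iter r j) + H (iter r j) + prox j (iter r j))"

lemma D_Rn: "u \<in> D \<Longrightarrow> u \<in> Rn n"
  by (simp add: edom_def)

lemma h_real: assumes "u \<in> D" shows "h u = ereal (H u)"
  using basic assms by (cases "h u") (auto simp: basic_assumptions_def proper_fun_def edom_def H_def)

lemma f_real: assumes "u \<in> D" shows "f u = ereal (F u)"
proof -
  have "u \<in> edom n f" using basic assms by (auto simp: basic_assumptions_def)
  then show ?thesis
    using basic by (cases "f u") (auto simp: basic_assumptions_def proper_fun_def edom_def F_def)
qed

lemma h_infinite: assumes "u \<in> Rn n" "u \<notin> D" shows "h u = \<infinity>"
  using assms by (auto simp: edom_def)

lemma f_not_MInf: "u \<in> Rn n \<Longrightarrow> f u \<noteq> -\<infinity>"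
  using basic by (auto simp: basic_assumptions_def proper_fun_def)

lemma convex_on_H: "convex_on D H"
proof (rule convex_onI)
  have h: "h ((1 - s) *\<^sub>R x + s *\<^sub>R y) \<le> ereal ((1 - s) * H x + s * H y)"
    if "0 \<le> s" "s \<le> 1" "x \<in> D" "y \<in> D" for s x y
  proof -
    have "h ((1 - s) *\<^sub>R x + s *\<^sub>R y) \<le> ereal (1 - s) * h x + ereal s * h y"
      using basic that by (auto simp: basic_assumptions_def convex_fun_def edom_def)
    then show ?thesis using that by (simp add: h_real)
  qed
  show conv: "convex D"
    unfolding convex_alt
  proof (intro ballI allI impI)
    fix x y and s :: real
    assume "x \<in> D" "y \<in> D" "0 \<le> s \<and> s \<le> 1"
    then show "(1 - s) *\<^sub>R x + s *\<^sub>R y \<in> D"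
      using h[of s x y] Rn_combination[of x n y "1 - s" s]
      by (cases "h ((1 - s) *\<^sub>R x + s *\<^sub>R y)") (auto simp: edom_def)
  qed
  fix s :: real and x y
  assume s: "0 < s" "s < 1" and xy: "x \<in> D" "y \<in> D"
  then have "(1 - s) *\<^sub>R x + s *\<^sub>R y \<in> D"
    using convexD_alt[OF conv, of x y s] by simp
  with h[of s x y] s xy show "H ((1 - s) *\<^sub>R x + s *\<^sub>R y) \<le> (1 - s) * H x + s * H y"
    by (simp add: h_real)
qed

lemma H_Lipschitz: assumes "u \<in> D" "v \<in> D" shows "\<bar>H u - H v\<bar> \<le> M\<^sub>h * norm (u - v)"
proof -
  have "\<bar>h u - h v\<bar> \<le> ereal (M\<^sub>h * norm (u - v))"
    using basic assms by (auto simp: basic_assumptions_def)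
  then show ?thesis using assms by (simp add: h_real)
qed

lemma norm_f': "p \<in> D \<Longrightarrow> norm (f' p) \<le> M\<^sub>f"
  using basic by (auto simp: basic_assumptions_def)

lemma inner_f'_le: assumes "p \<in> D" shows "\<bar>inner (f' p) v\<bar> \<le> M\<^sub>f * norm v"
  using Cauchy_Schwarz_ineq2[of "f' p" v] norm_f'[OF assms]
  by (meson mult_right_mono norm_ge_zero order_trans)

lemma lin_le: assumes "p \<in> D" "u \<in> D" shows "lin p u \<le> F u"
proof -
  have "f p + ereal (inner (f' p) (u - p)) - ereal 0 \<le> f u"
    using basic assms D_Rn by (auto simp: basic_assumptions_def eps_subdiff_def)
  then show ?thesis using assms by (simp add: f_real lin_def)
qed

lemma lin_affine: "lin p ((1 - s) *\<^sub>R x + s *\<^sub>R u) = (1 - s) * lin p x + s * lin p u"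
  by (simp add: lin_def inner_simps algebra_simps)

text \<open>
  The error of a cut is at most \<open>\<langle>f' u - f' p, u - p\<rangle>\<close>, and both subgradients are bounded by
  \<open>M\<^sub>f\<close>.
\<close>

lemma lin_gap: assumes "p \<in> D" "u \<in> D" shows "F u - lin p u \<le> 2 * M\<^sub>f * norm (u - p)"
proof -
  have "F u + inner (f' u) (p - u) \<le> F p"
    using lin_le[of u p] assms by (simp add: lin_def)
  moreover have "\<bar>inner (f' u) (p - u)\<bar> \<le> M\<^sub>f * norm (u - p)"
    using inner_f'_le[OF assms(2), of "p - u"] by (simp add: norm_minus_commute)
  moreover have "\<bar>inner (f' p) (u - p)\<bar> \<le> M\<^sub>f * norm (u - p)"
    using inner_f'_le[OF assms(1)] .
  ultimately show ?thesis by (simp add: lin_def)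
qed

lemma run0: "iter r 0 = x\<^sub>0" "center r 0 = x\<^sub>0" "best r 0 = x\<^sub>0" "zhat r 0 = x\<^sub>0" "cuts r (Suc 0) = {x\<^sub>0}"
  using run by (auto simp: is_RPB_def)

lemma zero_serious: "0 \<in> Serious"
  by (simp add: serious_def)

lemma iter_argmin:
  "1 \<le> j \<Longrightarrow> is_arg_min (prox_model f f' h lam r j) (\<lambda>u. u \<in> Rn n) (iter r j)"
  and best_argmin:
  "1 \<le> j \<Longrightarrow> is_arg_min (prox_obj f h lam r j) (\<lambda>u. u \<in> {iter r j, best r (j - 1)}) (best r j)"
  using run unfolding is_RPB_def by blast+

lemma run_update:
  assumes "1 \<le> j"
  shows "if j \<in> Serious then
        {iter r j} \<subseteq> cuts r (j + 1) \<and> cuts r (j + 1) \<subseteq> iter r ` {0..j} \<and>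
        center r j = iter r j \<and>
        (let k = card (Serious \<inter> {1..j}) in
          is_arg_min (\<lambda>u. f u + h u) (\<lambda>u. u \<in> {zhat r (k - 1), best r j}) (zhat r k))
       else
        center r j = center r (j - 1) \<and>
        active_set f f' r j \<union> {iter r j} \<subseteq> cuts r (j + 1) \<and>
        cuts r (j + 1) \<subseteq> cuts r j \<union> {iter r j}"
  using run assms unfolding is_RPB_def by blast

lemma serious_step:
  assumes "1 \<le> j" "j \<in> Serious"
  shows "iter r j \<in> cuts r (Suc j)" "cuts r (Suc j) \<subseteq> iter r ` {0..j}" "center r j = iter r j"
    "is_arg_min (\<lambda>u. f u + h u)
      (\<lambda>u. u \<in> {zhat r (card (Serious \<inter> {1..j}) - 1), best r j}) (zhat r (card (Serious \<inter> {1..j})))"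
  using run_update[OF assms(1)] assms(2) by (simp_all add: Let_def)

lemma null_step:
  assumes "1 \<le> j" "j \<notin> Serious"
  shows "center r j = center r (j - 1)" "iter r j \<in> cuts r (Suc j)"
    "active_set f f' r j \<subseteq> cuts r (Suc j)" "cuts r (Suc j) \<subseteq> cuts r j \<union> {iter r j}"
  using run_update[OF assms(1)] assms(2) by simp_all

lemma center_serious: "j \<in> Serious \<Longrightarrow> center r j = iter r j"
  using serious_step(3)[of j] run0 by (cases "j = 0") auto

lemma cuts_Suc: "cuts r (Suc j) \<subseteq> iter r ` {0..j} \<and> iter r j \<in> cuts r (Suc j)"
proof (induction j)
  case 0
  then show ?case by (simp add: run0)
next
  case (Suc j)
  show ?case
  proof (cases "Suc j \<in> Serious")
    case True
    then show ?thesis using serious_step[of "Suc j"] by auto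
  next
    case False
    have "cuts r (Suc j) \<subseteq> iter r ` {0..Suc j}" using Suc by fastforce
    then show ?thesis using null_step[of "Suc j"] False by fastforce
  qed
qed

lemma finite_cuts: "1 \<le> j \<Longrightarrow> finite (cuts r j)"
  using cuts_Suc[of "j - 1"] by (auto intro: finite_subset)

lemma prev_iter_in_cuts: "1 \<le> j \<Longrightarrow> iter r (j - 1) \<in> cuts r j"
  using cuts_Suc[of "j - 1"] by auto

lemma cuts_nonempty: "1 \<le> j \<Longrightarrow> cuts r j \<noteq> {}"
  using prev_iter_in_cuts by auto

lemma cut_model_real:
  assumes j: "1 \<le> j" and sub: "cuts r j \<subseteq> D"
  shows "cut_model f f' r j u = ereal (model j u)"
proof -
  have "(\<lambda>p. linearization f f' p u) ` cuts r j = ereal ` ((\<lambda>p. lin p u) ` cuts r j)"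
    using sub by (force simp: linearization_def lin_def f_real image_image)
  then show ?thesis
    using mono_Max_commute[of ereal "(\<lambda>p. lin p u) ` cuts r j"] finite_cuts[OF j] cuts_nonempty[OF j]
    by (simp add: cut_model_def model_def mono_def)
qed

lemma prox_model_le:
  assumes "1 \<le> j" "u \<in> Rn n"
  shows "prox_model f f' h lam r j (iter r j) \<le> prox_model f f' h lam r j u"
  using iter_argmin[OF assms(1)] assms(2) by (auto simp: is_arg_min_linorder)

text \<open>
  Membership of the iterates in \<open>dom h\<close> gives the cuts finite values, and the
  cuts of iteration \<open>j\<close> sit at earlier iterates; hence the strong induction. The starting point
  then shows that the minimum of the prox objective is finite.
\<close>

lemma iter_in_D: "iter r j \<in> D"
proof (induction j rule: less_induct)
  case (less j)
  show ?case
  proof (cases "j = 0")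
    case True
    then show ?thesis using run0 x0 by simp
  next
    case False
    then have j: "1 \<le> j" by simp
    have sub: "cuts r j \<subseteq> D" using cuts_Suc[of "j - 1"] less j by force
    have "prox_model f f' h lam r j x\<^sub>0 < \<infinity>"
      using x0 by (simp add: prox_model_def prox_term_def cut_model_real[OF j sub] h_real)
    then have "prox_model f f' h lam r j (iter r j) \<noteq> \<infinity>"
      using prox_model_le[OF j D_Rn[OF x0]] by auto
    then show ?thesis
      using iter_argmin[OF j] h_infinite[of "iter r j"]
      by (auto simp: prox_model_def prox_term_def cut_model_real[OF j sub] is_arg_min_def)
  qed
qed

lemma best_in_D: "best r j \<in> D"
proof (induction j)
  case 0
  then show ?case using run0 x0 by simp
next
  case (Suc j)
  then show ?case
    using best_argmin[of "Suc j"] iter_in_D[of "Suc j"] by (auto simp: is_arg_min_def)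
qed

lemma cuts_D: "1 \<le> j \<Longrightarrow> cuts r j \<subseteq> D"
  using cuts_Suc[of "j - 1"] iter_in_D by auto

lemmas model_real = cut_model_real[OF _ cuts_D]

lemma prox_model_real:
  "1 \<le> j \<Longrightarrow> u \<in> D \<Longrightarrow> prox_model f f' h lam r j u = ereal (model j u + H u + prox j u)"
  by (simp add: prox_model_def prox_term_def model_real h_real prox_def)

lemma prox_obj_real:
  "u \<in> D \<Longrightarrow> prox_obj f h lam r j u = ereal (F u + H u + prox j u)"
  by (simp add: prox_obj_def prox_term_def f_real h_real prox_def)

lemma gap_real: assumes j: "1 \<le> j" shows "gap n f f' h lam r j = ereal (t j)"
proof -
  have "(INF u\<in>Rn n. prox_model f f' h lam r j u) = prox_model f f' h lam r j (iter r j)"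
    using prox_model_le[OF j] D_Rn[OF iter_in_D]
    by (intro antisym INF_lower INF_greatest) auto
  then show ?thesis
    by (simp add: gap_def prox_model_real[OF j iter_in_D] prox_obj_real[OF best_in_D] t_def)
qed

lemma serious_iff: "1 \<le> j \<Longrightarrow> j \<in> Serious \<longleftrightarrow> t j \<le> \<delta>"
  by (simp add: serious_def gap_real)

lemma best_le:
  assumes "1 \<le> j" "u \<in> {iter r j, best r (j - 1)}"
  shows "F (best r j) + H (best r j) + prox j (best r j) \<le> F u + H u + prox j u"
proof -
  have "u \<in> D" using assms iter_in_D best_in_D by auto
  moreover have "prox_obj f h lam r j (best r j) \<le> prox_obj f h lam r j u"
    using best_argmin[OF assms(1)] assms(2) unfolding is_arg_min_linorder by blast
  ultimately show ?thesis by (simp add: prox_obj_real best_in_D)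
qed

lemma model_le: assumes "1 \<le> j" "u \<in> D" shows "model j u \<le> F u"
proof -
  have "lin p u \<le> F u" if "p \<in> cuts r j" for p
    using lin_le cuts_D that assms by blast
  then show ?thesis
    unfolding model_def using finite_cuts cuts_nonempty assms by (subst Max_le_iff) auto
qed

lemma lin_le_model: "1 \<le> j \<Longrightarrow> p \<in> cuts r j \<Longrightarrow> lin p u \<le> model j u"
  unfolding model_def using finite_cuts by auto

lemma iter_growth:
  assumes j: "1 \<le> j" and u: "u \<in> D" and Q: "finite Q"
    and act: "{p \<in> cuts r j. lin p (iter r j) = model j (iter r j)} \<subseteq> Q"
  shows "model j (iter r j) + H (iter r j) + prox j (iter r j) + (norm (u - iter r j))\<^sup>2 / (2 * lam)
    \<le> Max ((\<lambda>p. lin p u) ` Q) + H u + prox j u"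
  unfolding model_def prox_def
proof (rule prox_growth_of_active_pieces)
  show "Max ((\<lambda>p. lin p (iter r j)) ` cuts r j) + H (iter r j)
      + (norm (iter r j - center r (j - 1)))\<^sup>2 / (2 * lam)
    \<le> Max ((\<lambda>p. lin p y) ` cuts r j) + H y + (norm (y - center r (j - 1)))\<^sup>2 / (2 * lam)"
    if "y \<in> D" for y
    using prox_model_le[OF j D_Rn[OF that]]
    by (simp add: prox_model_real[OF j] that iter_in_D model_def prox_def)
qed (use j finite_cuts cuts_nonempty lin_affine convex_on_H iter_in_D u lam Q act in
  \<open>auto simp: model_def\<close>)

lemma iter_growth_model:
  assumes "1 \<le> j" "u \<in> D"
  shows "model j (iter r j) + H (iter r j) + prox j (iter r j) + (norm (u - iter r j))\<^sup>2 / (2 * lam)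
    \<le> model j u + H u + prox j u"
  using iter_growth[OF assms finite_cuts[OF assms(1)]] by (auto simp: model_def)


section \<open>The length of a cycle\<close>

text \<open>
  The cut at \<open>x\<^bsub>j-1\<^esub>\<close> always belongs to the model of iteration \<open>j\<close>, whether the
  preceding iteration was serious or null.
\<close>

lemma t_le_step: assumes j: "1 \<le> j" shows "t j \<le> 2 * M\<^sub>f * norm (iter r j - iter r (j - 1))"
proof -
  have "t j \<le> F (iter r j) - model j (iter r j)"
    using best_le[OF j, of "iter r j"] by (simp add: t_def)
  also have "\<dots> \<le> F (iter r j) - lin (iter r (j - 1)) (iter r j)"
    using lin_le_model[OF j prev_iter_in_cuts[OF j]] by simp
  also have "\<dots> \<le> 2 * M\<^sub>f * norm (iter r j - iter r (j - 1))"
    by (rule lin_gap[OF iter_in_D iter_in_D])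
  finally show ?thesis .
qed

text \<open>
  The next model retains the active cuts, so by growth its minimum value exceeds the present
  one by the squared step; the best objective value does not increase, as the prox center is
  unchanged.
\<close>

lemma t_decrease:
  assumes j: "1 \<le> j" and null: "j \<notin> Serious"
  shows "t (Suc j) + (norm (iter r (Suc j) - iter r j))\<^sup>2 / (2 * lam) \<le> t j"
proof -
  have prox: "prox (Suc j) u = prox j u" for u
    using null_step(1)[OF j null] by (simp add: prox_def)
  have act: "{p \<in> cuts r j. lin p (iter r j) = model j (iter r j)} \<subseteq> cuts r (Suc j)"
  proof
    fix p assume "p \<in> {p \<in> cuts r j. lin p (iter r j) = model j (iter r j)}"
    moreover from this have "p \<in> D" using cuts_D[OF j] by auto
    ultimately have "p \<in> active_set f f' r j"
      by (simp add: active_set_def model_real[OF j j] linearization_def f_real lin_def)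
    then show "p \<in> cuts r (Suc j)" using null_step(3)[OF j null] by auto
  qed
  have "model j (iter r j) + H (iter r j) + prox j (iter r j)
      + (norm (iter r (Suc j) - iter r j))\<^sup>2 / (2 * lam)
    \<le> model (Suc j) (iter r (Suc j)) + H (iter r (Suc j)) + prox (Suc j) (iter r (Suc j))"
    using iter_growth[OF j iter_in_D finite_cuts act] by (simp add: model_def prox)
  moreover have "F (best r (Suc j)) + H (best r (Suc j)) + prox (Suc j) (best r (Suc j))
      \<le> F (best r j) + H (best r j) + prox j (best r j)"
    using best_le[of "Suc j" "best r j"] by (simp add: prox)
  ultimately show ?thesis by (simp add: t_def)
qed

text \<open>
  Right after a serious step the prox center is \<open>x\<^sub>s\<close>. Twice the prox term is therefore bounded
  by the decrease of model plus \<open>h\<close> between \<open>x\<^sub>s\<close> and \<open>x\<^bsub>s+1\<^esub>\<close>, and this function is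
  Lipschitz with constant \<open>M\<^sub>f + M\<^sub>h\<close>.
\<close>

lemma first_step_bound:
  assumes s: "s \<in> Serious"
  shows "norm (iter r (Suc s) - iter r s) \<le> lam * (M\<^sub>f + M\<^sub>h)"
proof -
  let ?x = "iter r (Suc s)" and ?c = "iter r s"
  define d where "d = norm (?x - ?c)"
  have c: "center r s = ?c" by (rule center_serious[OF s])
  have prox: "prox (Suc s) ?c = 0" "prox (Suc s) ?x = d\<^sup>2 / (2 * lam)"
    by (simp_all add: prox_def c d_def)
  have "model (Suc s) ?x + H ?x + d\<^sup>2 / (2 * lam) + d\<^sup>2 / (2 * lam) \<le> model (Suc s) ?c + H ?c"
    using iter_growth_model[of "Suc s" ?c] iter_in_D
    by (simp add: prox d_def norm_minus_commute)
  moreover have "model (Suc s) ?c \<le> model (Suc s) ?x + M\<^sub>f * d"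
  proof -
    have "lin p ?c \<le> model (Suc s) ?x + M\<^sub>f * d" if "p \<in> cuts r (Suc s)" for p
    proof -
      have "lin p ?c = lin p ?x + inner (f' p) (?c - ?x)" by (simp add: lin_def inner_simps)
      moreover have "inner (f' p) (?c - ?x) \<le> M\<^sub>f * d"
        using inner_f'_le[of p "?c - ?x"] cuts_D[of "Suc s"] that
        by (auto simp: d_def norm_minus_commute)
      ultimately show ?thesis using lin_le_model[of "Suc s" p ?x] that by simp
    qed
    then show ?thesis
      using finite_cuts[of "Suc s"] cuts_nonempty[of "Suc s"]
      unfolding model_def[of "Suc s" ?c] by (subst Max_le_iff) auto
  qed
  moreover have "H ?c \<le> H ?x + M\<^sub>h * d"
    using H_Lipschitz[OF iter_in_D iter_in_D, of s "Suc s"] by (simp add: d_def norm_minus_commute)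
  ultimately have "d\<^sup>2 / lam \<le> (M\<^sub>f + M\<^sub>h) * d" by (simp add: algebra_simps)
  then have "d * d \<le> d * (lam * (M\<^sub>f + M\<^sub>h))"
    using lam by (simp add: field_simps power2_eq_square)
  moreover have "0 \<le> d" "0 \<le> lam * (M\<^sub>f + M\<^sub>h)" using lam Mf Mh by (auto simp: d_def)
  ultimately have "d \<le> lam * (M\<^sub>f + M\<^sub>h)" by (cases "d = 0") auto
  then show ?thesis by (simp add: d_def)
qed

lemma t_recursion:
  assumes j: "1 \<le> j" and null: "j \<notin> Serious" and pos: "0 \<le> t (Suc j)"
  shows "t (Suc j) + (t (Suc j))\<^sup>2 / (8 * lam * (M\<^sub>f + M\<^sub>h) * M\<^sub>f) \<le> t j"
proof -
  let ?d = "norm (iter r (Suc j) - iter r j)"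
  have "(t (Suc j))\<^sup>2 \<le> (2 * M\<^sub>f * ?d)\<^sup>2"
    using t_le_step[of "Suc j"] pos by (intro power_mono) auto
  also have "\<dots> = 4 * (M\<^sub>f * M\<^sub>f) * ?d\<^sup>2" by (simp add: power2_eq_square)
  also have "\<dots> \<le> 4 * ((M\<^sub>f + M\<^sub>h) * M\<^sub>f) * ?d\<^sup>2"
    using Mf Mh by (intro mult_right_mono mult_left_mono) auto
  finally have "(t (Suc j))\<^sup>2 / (8 * lam * (M\<^sub>f + M\<^sub>h) * M\<^sub>f)
      \<le> (4 * ((M\<^sub>f + M\<^sub>h) * M\<^sub>f) * ?d\<^sup>2) / (8 * lam * (M\<^sub>f + M\<^sub>h) * M\<^sub>f)"
    using lam Mf Mh by (intro divide_right_mono) auto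
  also have "\<dots> = ?d\<^sup>2 / (2 * lam)"
    using lam Mf Mh by (simp add: divide_simps)
  finally show ?thesis using t_decrease[OF j null] by simp
qed

text \<open>
  If all of \<open>s+1, \<dots>, s+1+m\<close> were null for \<open>m = \<lceil>2b/\<delta>\<rceil>\<close>, the gaps would stay above \<open>\<delta>\<close> for
  too many steps of the recursion. The constant \<open>2\<close> accounts for the first index \<open>s+1\<close> and for
  rounding up.
\<close>

lemma next_serious:
  assumes s: "s \<in> Serious"
  obtains s' where "s' \<in> Serious" "s < s'"
    "real s' \<le> real s + 2 + 16 * lam * (M\<^sub>f + M\<^sub>h) * M\<^sub>f / \<delta>"
proof -
  define b where "b = 8 * lam * (M\<^sub>f + M\<^sub>h) * M\<^sub>f"
  define m where "m = nat \<lceil>2 * b / \<delta>\<rceil>"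
  have b: "b > 0" using lam Mf Mh by (simp add: b_def)
  have m: "2 * b / \<delta> \<le> real m" "real m \<le> 2 * b / \<delta> + 1"
    using b delta by (auto simp: m_def real_nat_ceiling_ge of_nat_ceiling of_int_ceiling_le_add_one)
  have "\<exists>i\<le>m. t (Suc s + i) \<le> \<delta>"
  proof (rule ccontr)
    assume "\<not> ?thesis"
    then have above: "\<And>i. i \<le> m \<Longrightarrow> \<delta> < t (Suc s + i)" by auto
    have "real m < 2 * b / \<delta>"
    proof (rule quadratic_decay_steps[OF b delta, of "\<lambda>i. t (Suc s + i)"])
      have "t (Suc s) \<le> 2 * M\<^sub>f * norm (iter r (Suc s) - iter r s)"
        using t_le_step[of "Suc s"] by simp
      also have "\<dots> \<le> 2 * M\<^sub>f * (lam * (M\<^sub>f + M\<^sub>h))"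
        using Mf first_step_bound[OF s] by (intro mult_left_mono) auto
      also have "\<dots> = b / 4" by (simp add: b_def)
      finally show "t (Suc s + 0) \<le> b / 4" by simp
    next
      fix i assume i: "i < m"
      have "Suc s + i \<notin> Serious" using above[of i] i serious_iff[of "Suc s + i"] by auto
      then show "t (Suc s + Suc i) + (t (Suc s + Suc i))\<^sup>2 / b \<le> t (Suc s + i)"
        using t_recursion[of "Suc s + i"] above[of "Suc i"] i delta by (simp add: b_def)
    qed (use above in auto)
    with m show False by simp
  qed
  then obtain i where i: "i \<le> m" "t (Suc s + i) \<le> \<delta>" by auto
  show thesis
  proof (rule that[of "Suc s + i"])
    show "Suc s + i \<in> Serious" using i serious_iff[of "Suc s + i"] by simp
    show "real (Suc s + i) \<le> real s + 2 + 16 * lam * (M\<^sub>f + M\<^sub>h) * M\<^sub>f / \<delta>"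
      using i(1) m(2) by (simp add: b_def)
  qed simp
qed

lemma infinite_serious: "infinite Serious"
proof
  assume fin: "finite Serious"
  then have "Max Serious \<in> Serious" using zero_serious by (intro Max_in) auto
  then obtain s' where "s' \<in> Serious" "Max Serious < s'" by (rule next_serious)
  then show False using fin by (auto simp: not_le[symmetric])
qed

definition \<sigma> where "\<sigma> = enumerate Serious"

lemma serious_idx_eq: "serious_idx n f f' h lam \<delta> r = \<sigma>"
  by (simp add: serious_idx_def \<sigma>_def fun_eq_iff)

lemma \<sigma>_in: "\<sigma> k \<in> Serious"
  by (simp add: \<sigma>_def enumerate_in_set infinite_serious)

lemma \<sigma>_mono: "strict_mono \<sigma>"
  unfolding \<sigma>_def by (rule strict_mono_enumerate[OF infinite_serious])

lemma range_\<sigma>: "range \<sigma> = Serious"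
  unfolding \<sigma>_def by (rule range_enumerate[OF infinite_serious])

lemma \<sigma>_0: "\<sigma> 0 = 0"
  using zero_serious by (simp add: \<sigma>_def enumerate_0 Least_eq_0)

lemma \<sigma>_pos: "1 \<le> k \<Longrightarrow> 1 \<le> \<sigma> k"
  using strict_monoD[OF \<sigma>_mono, of 0 k] by simp

lemma \<sigma>_Suc_le: "s' \<in> Serious \<Longrightarrow> \<sigma> k < s' \<Longrightarrow> \<sigma> (Suc k) \<le> s'"
  unfolding \<sigma>_def enumerate_Suc''[OF infinite_serious] by (rule Least_le) simp

lemma \<sigma>_bound: "real (\<sigma> k) \<le> real k * (2 + 16 * lam * (M\<^sub>f + M\<^sub>h) * M\<^sub>f / \<delta>)"
proof -
  define L where "L = 2 + 16 * lam * (M\<^sub>f + M\<^sub>h) * M\<^sub>f / \<delta>"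
  have "real (\<sigma> k) \<le> real k * L"
  proof (induction k)
    case 0
    then show ?case by (simp add: \<sigma>_0)
  next
    case (Suc k)
    obtain s' where s': "s' \<in> Serious" "\<sigma> k < s'"
      and "real s' \<le> real (\<sigma> k) + 2 + 16 * lam * (M\<^sub>f + M\<^sub>h) * M\<^sub>f / \<delta>"
      by (rule next_serious[OF \<sigma>_in])
    then have "real s' \<le> real (\<sigma> k) + L" unfolding L_def by linarith
    moreover have "real (\<sigma> (Suc k)) \<le> real s'"
      using \<sigma>_Suc_le[OF s'] by (rule of_nat_mono)
    moreover have "real (Suc k) * L = real k * L + L" by (simp add: distrib_right)
    ultimately show ?case using Suc.IH by linarith
  qed
  then show ?thesis by (simp only: L_def)
qed

lemma null_between:
  assumes "\<sigma> k < i" "i < \<sigma> (Suc k)" shows "i \<notin> Serious"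
  using \<sigma>_Suc_le[of i k] assms by auto

lemma center_cycle:
  "\<sigma> k + d < \<sigma> (Suc k) \<Longrightarrow> center r (\<sigma> k + d) = iter r (\<sigma> k)"
proof (induction d)
  case 0
  then show ?case by (simp add: center_serious \<sigma>_in)
next
  case (Suc d)
  then show ?case using null_step(1)[of "\<sigma> k + Suc d"] null_between[of k "\<sigma> k + Suc d"] by simp
qed

lemma center_before_serious: "center r (\<sigma> (Suc k) - 1) = iter r (\<sigma> k)"
  using center_cycle[of k "\<sigma> (Suc k) - 1 - \<sigma> k"] strict_monoD[OF \<sigma>_mono, of k "Suc k"] by simp

text \<open>
  The counter by which the method indexes \<open>zhat\<close> agrees with the position in the enumeration
  of the serious iterations.
\<close>

lemma card_serious: "card (Serious \<inter> {1..\<sigma> k}) = k"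
proof -
  have "Serious \<inter> {1..\<sigma> k} = \<sigma> ` {1..k}"
  proof (intro equalityI subsetI)
    fix j assume "j \<in> Serious \<inter> {1..\<sigma> k}"
    then obtain i where i: "j = \<sigma> i" "1 \<le> \<sigma> i" "\<sigma> i \<le> \<sigma> k" using range_\<sigma> by auto
    then have "i \<le> k" using strict_mono_less_eq[OF \<sigma>_mono] by simp
    moreover have "1 \<le> i" using i(2) \<sigma>_0 by (cases i) auto
    ultimately show "j \<in> \<sigma> ` {1..k}" using i(1) by simp
  next
    fix j assume "j \<in> \<sigma> ` {1..k}"
    then show "j \<in> Serious \<inter> {1..\<sigma> k}"
      using \<sigma>_in \<sigma>_pos strict_mono_less_eq[OF \<sigma>_mono] by auto
  qed
  moreover have "inj_on \<sigma> {1..k}" using strict_mono_imp_inj_on[OF \<sigma>_mono] by (rule inj_on_subset) auto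
  ultimately show ?thesis by (simp add: card_image)
qed


section \<open>The residual of a serious iterate\<close>

definition z where "z k = iter r (\<sigma> k)"

lemma zseq_eq: "zseq n f f' h lam \<delta> r = z"
  by (simp add: zseq_def serious_idx_eq z_def fun_eq_iff)

lemma z_in_D: "z k \<in> D"
  by (simp add: z_def iter_in_D)

lemma prox_serious: "prox (\<sigma> (Suc k)) u = (norm (u - z k))\<^sup>2 / (2 * lam)"
  by (simp only: prox_def center_before_serious z_def)

abbreviation dlt where "dlt \<equiv> delta_seq n f f' h lam \<delta> r"

lemma delta_seq_real:
  "dlt (Suc k) = F (best r (\<sigma> (Suc k))) + H (best r (\<sigma> (Suc k)))
    - (model (\<sigma> (Suc k)) (z (Suc k)) + H (z (Suc k)) + prox (\<sigma> (Suc k)) (z (Suc k)))"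
proof -
  have "1 \<le> \<sigma> (Suc k)" by (rule \<sigma>_pos) simp
  then show ?thesis
    by (simp add: delta_seq_def serious_idx_eq zseq_eq Let_def f_real h_real best_in_D z_in_D
        model_real prox_serious)
qed

text \<open>
  The gap includes the prox term of the best point, which \<open>\<delta>\<^sub>k\<close> leaves out; so \<open>\<delta>\<^sub>k\<close> is at most
  the gap, which is at most \<open>\<delta>\<close> at a serious iteration.
\<close>

lemma delta_seq_le: "dlt (Suc k) \<le> \<delta>"
proof -
  have "t (\<sigma> (Suc k)) \<le> \<delta>"
    using serious_iff[of "\<sigma> (Suc k)"] \<sigma>_pos[of "Suc k"] \<sigma>_in by simp
  moreover have "0 \<le> prox (\<sigma> (Suc k)) (best r (\<sigma> (Suc k)))"
    using lam by (simp add: prox_def)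
  ultimately show ?thesis by (simp add: delta_seq_real t_def z_def)
qed

text \<open>
  This is the growth bound at the serious iterate, with the model replaced by the larger \<open>f\<close> on
  the right. The centers of consecutive cycles match, so the differences of squares telescope.
\<close>

lemma cycle_descent:
  assumes u: "u \<in> D"
  shows "F (best r (\<sigma> (Suc k))) + H (best r (\<sigma> (Suc k))) - (F u + H u)
    \<le> dlt (Suc k) + ((norm (u - z k))\<^sup>2 - (norm (u - z (Suc k)))\<^sup>2) / (2 * lam)"
proof -
  have s: "1 \<le> \<sigma> (Suc k)" by (rule \<sigma>_pos) simp
  show ?thesis
    using iter_growth_model[OF s u] model_le[OF s u]
    by (simp add: delta_seq_real prox_serious z_def[symmetric] diff_divide_distrib)
qed

lemma zhat_step:
  "is_arg_min (\<lambda>u. f u + h u) (\<lambda>u. u \<in> {zhat r k, best r (\<sigma> (Suc k))}) (zhat r (Suc k))"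
  using serious_step(4)[of "\<sigma> (Suc k)"] \<sigma>_pos[of "Suc k"] \<sigma>_in card_serious[of "Suc k"] by simp

lemma zhat_in_D: "zhat r k \<in> D"
proof (induction k)
  case 0
  then show ?case using run0 x0 by simp
next
  case (Suc k)
  then show ?case using zhat_step[of k] best_in_D by (auto simp: is_arg_min_def)
qed

lemma zhat_le:
  "u \<in> {zhat r k, best r (\<sigma> (Suc k))} \<Longrightarrow>
    F (zhat r (Suc k)) + H (zhat r (Suc k)) \<le> F u + H u"
proof -
  assume u: "u \<in> {zhat r k, best r (\<sigma> (Suc k))}"
  then have "u \<in> D" using zhat_in_D best_in_D by auto
  moreover have "f (zhat r (Suc k)) + h (zhat r (Suc k)) \<le> f u + h u"
    using zhat_step[of k] u unfolding is_arg_min_linorder by blast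
  ultimately show ?thesis using zhat_in_D by (simp add: f_real h_real)
qed

lemma telescoped_descent:
  assumes u: "u \<in> D"
  shows "real k * (F (zhat r k) + H (zhat r k) - (F u + H u))
    \<le> (\<Sum>i=1..k. dlt i) + ((norm (u - z 0))\<^sup>2 - (norm (u - z k))\<^sup>2) / (2 * lam)"
proof (induction k)
  case 0
  then show ?case by simp
next
  case (Suc k)
  let ?\<phi> = "\<lambda>u. F u + H u"
  have "real k * (?\<phi> (zhat r (Suc k)) - ?\<phi> u) \<le> real k * (?\<phi> (zhat r k) - ?\<phi> u)"
    using zhat_le[of "zhat r k" k] by (intro mult_left_mono) auto
  moreover have "?\<phi> (zhat r (Suc k)) - ?\<phi> u
    \<le> dlt (Suc k) + ((norm (u - z k))\<^sup>2 - (norm (u - z (Suc k)))\<^sup>2) / (2 * lam)"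
    using cycle_descent[OF u, of k] zhat_le[of "best r (\<sigma> (Suc k))" k] by simp
  moreover have "real (Suc k) * (?\<phi> (zhat r (Suc k)) - ?\<phi> u)
      = real k * (?\<phi> (zhat r (Suc k)) - ?\<phi> u) + (?\<phi> (zhat r (Suc k)) - ?\<phi> u)"
    by (simp add: distrib_right)
  moreover have "(\<Sum>i=1..Suc k. dlt i) = (\<Sum>i=1..k. dlt i) + dlt (Suc k)" by simp
  ultimately show ?case using Suc.IH unfolding diff_divide_distrib by linarith
qed

abbreviation v where "v \<equiv> vhat n f f' h lam \<delta> r"
abbreviation \<epsilon> where "\<epsilon> \<equiv> epshat n f f' h lam \<delta> r"

text \<open>
  The difference of squared distances to \<open>z\<^sub>0\<close> and \<open>z\<^sub>k\<close> is affine in the point, with gradient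
  proportional to \<open>vhat\<^sub>k\<close>. So the part of \<open>epshat\<^sub>k\<close> that refers to \<open>zhat\<^sub>k\<close> and the inner
  product combine to the same difference taken at \<open>x\<close>.
\<close>

lemma epshat_plus_inner:
  assumes k: "1 \<le> k"
  shows "\<epsilon> k + inner (v k) (zhat r k - x)
    = (\<Sum>i=1..k. dlt i) / real k + ((norm (x - z 0))\<^sup>2 - (norm (x - z k))\<^sup>2) / (2 * lam * real k)"
proof -
  let ?w = "zhat r k" and ?c = "2 * lam * real k"
  have "inner (v k) (?w - x) = inner (z 0 - z k) (?w - x) / (lam * real k)"
    unfolding vhat_def zseq_eq inner_scaleR_left by (simp only: divide_inverse_commute)
  also have "\<dots> = 2 * inner (z 0 - z k) (?w - x) / ?c"
    by (simp only: mult.assoc mult_divide_mult_cancel_left[of 2] numeral_neq_zero)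
  finally have v: "inner (v k) (?w - x) = 2 * inner (z 0 - z k) (?w - x) / ?c" .
  have "\<epsilon> k = (\<Sum>i=1..k. dlt i) / real k + ((norm (?w - z 0))\<^sup>2 - (norm (?w - z k))\<^sup>2) / ?c"
    by (simp only: epshat_def zseq_eq Let_def)
  then show ?thesis
    unfolding v norm_sq_diff_shift[of x "z 0" "z k" ?w] add_divide_distrib by linarith
qed

lemma epshat_plus_inner_le:
  assumes k: "1 \<le> k" and S: "D \<subseteq> S" "bounded S" "x \<in> S"
  shows "\<epsilon> k + inner (v k) (zhat r k - x) \<le> \<delta> + (diameter S)\<^sup>2 / (2 * lam * real k)"
proof -
  have "dlt i \<le> \<delta>" if "i \<in> {1..k}" for i
    using delta_seq_le[of "i - 1"] that by simp
  then have "(\<Sum>i=1..k. dlt i) \<le> \<delta> * real k"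
    using sum_bounded_above[of "{1..k}" dlt \<delta>] by (simp add: mult.commute)
  then have "(\<Sum>i=1..k. dlt i) / real k \<le> \<delta>"
    using k by (simp add: field_simps)
  moreover have "((norm (x - z 0))\<^sup>2 - (norm (x - z k))\<^sup>2) / (2 * lam * real k)
      \<le> (diameter S)\<^sup>2 / (2 * lam * real k)"
  proof (rule divide_right_mono)
    have "norm (x - z 0) \<le> diameter S"
      using diameter_bounded_bound[OF S(2,3), of "z 0"] z_in_D[of 0] S(1) by (auto simp: dist_norm)
    then have "(norm (x - z 0))\<^sup>2 \<le> (diameter S)\<^sup>2" by (intro power_mono) auto
    then show "(norm (x - z 0))\<^sup>2 - (norm (x - z k))\<^sup>2 \<le> (diameter S)\<^sup>2"
      by (smt (verit) zero_le_power2)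
  qed (use lam in simp)
  ultimately show ?thesis unfolding epshat_plus_inner[OF k] by linarith
qed

lemma etahat_bounds:
  assumes k: "1 \<le> k" and S: "D \<subseteq> S" "bounded S"
  shows "x \<in> S \<Longrightarrow> \<epsilon> k + inner (v k) (zhat r k - x) \<le> etahat n f f' h lam \<delta> r S k"
    and "etahat n f f' h lam \<delta> r S k \<le> \<delta> + (diameter S)\<^sup>2 / (2 * lam * real k)"
proof -
  let ?B = "\<delta> + (diameter S)\<^sup>2 / (2 * lam * real k) - \<epsilon> k"
  have le: "inner (v k) (zhat r k - x) \<le> ?B" if "x \<in> S" for x
    using epshat_plus_inner_le[OF k S that] by linarith
  have "(SUP x\<in>S. inner (v k) (zhat r k - x)) \<le> ?B"
    by (rule cSUP_least) (use le x0 S(1) in auto)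
  then show "etahat n f f' h lam \<delta> r S k \<le> \<delta> + (diameter S)\<^sup>2 / (2 * lam * real k)"
    by (simp add: etahat_def)
  have bdd: "bdd_above ((\<lambda>x. inner (v k) (zhat r k - x)) ` S)"
    by (rule bdd_aboveI2) (rule le)
  then show "\<epsilon> k + inner (v k) (zhat r k - x) \<le> etahat n f f' h lam \<delta> r S k" if "x \<in> S"
    using cSUP_upper[OF that bdd] by (simp add: etahat_def)
qed

text \<open>
  The right-hand side of the telescoped inequality, divided by \<open>k\<close>, is one of the terms in the
  supremum that defines \<open>etahat\<^sub>k\<close>.
\<close>

lemma zhat_eps_optimal:
  assumes k: "1 \<le> k" and S: "D \<subseteq> S" "bounded S"
  shows "0 \<in> eps_subdiff n (etahat n f f' h lam \<delta> r S k) (\<lambda>u. f u + h u) (zhat r k)"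
proof -
  let ?\<eta> = "etahat n f f' h lam \<delta> r S k"
  have "F (zhat r k) + H (zhat r k) - ?\<eta> \<le> F u + H u" if "u \<in> D" for u
  proof -
    have "F (zhat r k) + H (zhat r k) - (F u + H u)
        \<le> ((\<Sum>i=1..k. dlt i) + ((norm (u - z 0))\<^sup>2 - (norm (u - z k))\<^sup>2) / (2 * lam)) / real k"
      using telescoped_descent[OF that, of k] k by (simp add: pos_le_divide_eq mult.commute)
    also have "\<dots> = \<epsilon> k + inner (v k) (zhat r k - u)"
      unfolding epshat_plus_inner[OF k] by (simp add: add_divide_distrib)
    also have "\<dots> \<le> ?\<eta>" using etahat_bounds(1)[OF k S] that S(1) by auto
    finally show ?thesis by simp
  qed
  then have "f (zhat r k) + h (zhat r k) - ereal ?\<eta> \<le> f u + h u" if "u \<in> Rn n" for u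
    using that h_infinite[of u] f_not_MInf[of u]
    by (cases "u \<in> D") (simp_all add: f_real h_real zhat_in_D)
  then show ?thesis by (auto simp: eps_subdiff_def Rn_def)
qed

end


theorem corollary6p5:
  fixes C :: real
  assumes "C > 0"
  shows "\<exists>cbar::real. \<forall>(n::nat) f f' h M\<^sub>f M\<^sub>h M S D\<^sub>S eps x\<^sub>0 lam \<delta> r.
    basic_assumptions n f f' h M\<^sub>f M\<^sub>h \<and> 0 \<le> M\<^sub>f \<and> 0 \<le> M\<^sub>h \<and> M = M\<^sub>f + M\<^sub>h \<and>
    S \<subseteq> Rn n \<and> compact S \<and> convex S \<and> edom n h \<subseteq> S \<and> D\<^sub>S = diameter S \<and>
    0 < eps \<and> x\<^sub>0 \<in> edom n h \<and> \<delta> = eps / 6 \<and> 0 < lam \<and>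
    ereal eps / ereal (C * M * M\<^sub>f) \<le> ereal lam \<and> lam \<le> C * D\<^sub>S\<^sup>2 / eps \<and>
    is_RPB n f f' h x\<^sub>0 lam \<delta> r
    \<longrightarrow> (\<exists>k\<ge>1. serious_idx_exists n f f' h lam \<delta> r k \<and>
          solution_pair n f h eps (zhat r k) (etahat n f f' h lam \<delta> r S k) \<and>
          real (serious_idx n f f' h lam \<delta> r k) \<le> cbar * (M * M\<^sub>f * D\<^sub>S\<^sup>2 / eps\<^sup>2 + 1))"
proof (intro exI[of _ "(1 + C) * (2 * C + 96)"] allI impI, elim conjE)
  fix n f f' h M\<^sub>f M\<^sub>h M S D\<^sub>S eps x\<^sub>0 lam \<delta> r
  assume basic: "basic_assumptions n f f' h M\<^sub>f M\<^sub>h" and Mf: "0 \<le> M\<^sub>f" and Mh: "0 \<le> M\<^sub>h"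
    and M: "M = M\<^sub>f + M\<^sub>h" and cpt: "compact S" and dom: "edom n h \<subseteq> S"
    and D\<^sub>S: "D\<^sub>S = diameter S" and eps: "0 < eps" and x0: "x\<^sub>0 \<in> edom n h"
    and \<delta>: "\<delta> = eps / 6" and lam: "0 < lam"
    and lower: "ereal eps / ereal (C * M * M\<^sub>f) \<le> ereal lam"
    and upper: "lam \<le> C * D\<^sub>S\<^sup>2 / eps"
    and run: "is_RPB n f f' h x\<^sub>0 lam \<delta> r"
  \<comment> \<open>If the product vanished, the lower bound on \<open>lam\<close> would be infinite.\<close>
  have MMf: "C * M * M\<^sub>f \<noteq> 0"
    using lower eps by (auto simp: divide_ereal_def)
  then have Mf_pos: "0 < M\<^sub>f" using Mf by (cases "M\<^sub>f = 0") auto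
  have M_pos: "0 < M" using M Mf_pos Mh by simp
  have lower': "eps \<le> C * lam * M * M\<^sub>f"
    using lower MMf M_pos Mf_pos assms by (simp add: field_simps)
  have upper': "lam * eps \<le> C * D\<^sub>S\<^sup>2" using upper eps by (simp add: field_simps)
  interpret rpb n f f' h M\<^sub>f M\<^sub>h x\<^sub>0 lam \<delta> r
    by unfold_locales (use basic run x0 lam eps \<delta> Mf_pos Mh in auto)
  define q where "q = D\<^sub>S\<^sup>2 / (lam * eps)"
  \<comment> \<open>This absorbs the rounding of the number of cycles: \<open>k \<le> q + 1 \<le> (1 + C) * q\<close>.\<close>
  have q: "1 \<le> C * q" using upper' lam eps by (simp add: q_def field_simps)
  then have q_pos: "0 < q" using assms by (metis less_le_trans zero_less_mult_pos zero_less_one)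
  define k where "k = nat \<lceil>q\<rceil>"
  have k_ge: "q \<le> real k" and k_le: "real k \<le> q + 1"
    using q_pos by (auto simp: k_def real_nat_ceiling_ge of_nat_ceiling of_int_ceiling_le_add_one)
  have k: "1 \<le> k" using k_ge q_pos by (cases k) auto
  have bS: "bounded S" by (rule compact_imp_bounded[OF cpt])
  have "etahat n f f' h lam \<delta> r S k \<le> eps / 6 + D\<^sub>S\<^sup>2 / (2 * lam * real k)"
    using etahat_bounds(2)[OF k dom bS] by (simp add: \<delta> D\<^sub>S)
  also have "D\<^sub>S\<^sup>2 / (2 * lam * real k) \<le> eps / 2"
    using k_ge k lam eps by (simp add: q_def field_simps)
  finally have "etahat n f f' h lam \<delta> r S k \<le> eps" using eps by simp
  then have "solution_pair n f h eps (zhat r k) (etahat n f f' h lam \<delta> r S k)"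
    using zhat_eps_optimal[OF k dom bS] by (simp add: solution_pair_def)
  moreover have "serious_idx_exists n f f' h lam \<delta> r k"
    using infinite_serious by (simp add: serious_idx_exists_def)
  moreover have "real (serious_idx n f f' h lam \<delta> r k)
      \<le> ((1 + C) * (2 * C + 96)) * (M * M\<^sub>f * D\<^sub>S\<^sup>2 / eps\<^sup>2 + 1)"
  proof -
    define p where "p = lam * M * M\<^sub>f / eps"
    \<comment> \<open>This absorbs the constant part of the cycle length; \<open>96 * p\<close> is
      \<open>16 * lam * M * M\<^sub>f / \<delta>\<close> for \<open>\<delta> = eps / 6\<close>.\<close>
    have p: "1 \<le> C * p" using lower' eps by (simp add: p_def field_simps)
    have p_pos: "0 < p" using lam M_pos Mf_pos eps by (simp add: p_def)
    have "real (\<sigma> k) \<le> real k * (2 + 96 * p)"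
      using \<sigma>_bound[of k] eps by (simp add: M \<delta> p_def mult_ac)
    also have "\<dots> \<le> ((1 + C) * q) * ((2 * C + 96) * p)"
    proof (rule mult_mono)
      show "real k \<le> (1 + C) * q" using k_le q by (simp add: distrib_right)
      show "2 + 96 * p \<le> (2 * C + 96) * p" using p by (simp add: distrib_right)
    qed (use assms p_pos q_pos in auto)
    also have "\<dots> = ((1 + C) * (2 * C + 96)) * (q * p)" by (simp only: mult_ac)
    also have "q * p = M * M\<^sub>f * D\<^sub>S\<^sup>2 / eps\<^sup>2"
      using lam eps by (simp add: q_def p_def field_simps power2_eq_square)
    also have "((1 + C) * (2 * C + 96)) * (M * M\<^sub>f * D\<^sub>S\<^sup>2 / eps\<^sup>2)
        \<le> ((1 + C) * (2 * C + 96)) * (M * M\<^sub>f * D\<^sub>S\<^sup>2 / eps\<^sup>2 + 1)"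
      using assms by (intro mult_left_mono) auto
    finally show ?thesis by (simp add: serious_idx_eq)
  qed
  ultimately show "\<exists>k\<ge>1. serious_idx_exists n f f' h lam \<delta> r k \<and>
      solution_pair n f h eps (zhat r k) (etahat n f f' h lam \<delta> r S k) \<and>
      real (serious_idx n f f' h lam \<delta> r k)
        \<le> ((1 + C) * (2 * C + 96)) * (M * M\<^sub>f * D\<^sub>S\<^sup>2 / eps\<^sup>2 + 1)"
    using k by blast
qed

end
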